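(* Let $1\leq k\leq d\leq d'$ with $k\mid dd'$, and let $p\leq q$ be positive integers. Suppose $\{|\psi_j\rangle\}_{j=1}^{N}$ is an $N$-number SUEB$k$ in $\mathbb{C}^{d}\otimes\mathbb{C}^{d'}$ obtained by one of the following four constructions: the coefficient matrices $A_j=(a^{(j)}_{x,y})$ (where $|\psi_j\rangle=\sum_{x,y}a^{(j)}_{x,y}|x\rangle|y\rangle$) form an orthogonal basis, consisting of matrices with exactly $k$ nonzero singular values all equal to $1/\sqrt{k}$, of the subspace $\mathcal{L}\subseteq\mathcal{M}_{d\times d'}$ of matrices supported on a region $R$, where $R$ is one of: (1) ($k\mid d$) the first $d'-i$ columns, for some $i\in\{1,\dots,k-1\}$ with $d'-i\geq k$; (2) ($d=sk+r$, $0<r<k$) the top-left $sk\times(d'-t)$ block, for some $t\in\{0,\dots,k-r-1\}$ with $d'-t\geq k$; (3) ($k\mid d'$) the first $d-i$ rows, for some $i\in\{1,\dots,k-1\}$ with $d-i\geq k$; (4) ($d'=sk+r$, $0<r<k$) the top-left $(d-t)\times sk$ block, for some $t\in\{0,\dots,k-r-1\}$ with $d-t\geq k$. Then there is a $(pqdd'-p(dd'-N))$-number SUEB$pk$ in $\mathbb{C}^{pd}\otimes\mathbb{C}^{qd'}$.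
   Context: Here $\mathcal{M}_{d\times d'}$ is the space of $d\times d'$ complex matrices, and states are identified with coefficient matrices in the computational bases. A pure state $|\psi\rangle\in\mathbb{C}^{n}\otimes\mathbb{C}^{n'}$ is a special entangled state with Schmidt number $k$ if it has Schmidt rank $k$ and all nonzero Schmidt coefficients equal to $1/\sqrt{k}$. A set $\{|\psi_i\rangle: i=1,\dots,M\}$ with $M<nn'$ of such states in $\mathbb{C}^{n}\otimes\mathbb{C}^{n'}$ is an $M$-number SUEB$k$ if (i) $\langle\psi_i|\psi_j\rangle=\delta_{ij}$, and (ii) any state $|\phi\rangle$ orthogonal to all $|\psi_i\rangle$ is not a special entangled state with Schmidt number $k$. *)

theory Defs
  imports
    "HOL-Computational_Algebra.Fundamental_Theorem_Algebra"
    "Jordan_Normal_Form.Char_Poly"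
    "Jordan_Normal_Form.Schur_Decomposition"
    "Jordan_Normal_Form.VS_Connect"
begin

text \<open>
  A vector of \<open>\<complex>\<^sup>n \<otimes> \<complex>\<^sup>n'\<close> is identified with its coefficient matrix in the computational
  bases: \<open>\<Sum>x<n. \<Sum>y<n'. a\<^sub>x\<^sub>y |x\<rangle>|y\<rangle>\<close> is the matrix with entries \<open>a\<^sub>x\<^sub>y\<close> in \<open>carrier_mat n n'\<close>.
  All indices of rows, columns and basis vectors start at 0.
\<close>

definition braket :: "nat \<Rightarrow> nat \<Rightarrow> complex mat \<Rightarrow> complex mat \<Rightarrow> complex" where
  "braket n n' \<phi> \<psi> = (\<Sum>x<n. \<Sum>y<n'. cnj (\<phi> $$ (x, y)) * \<psi> $$ (x, y))"

definition pure_state :: "nat \<Rightarrow> nat \<Rightarrow> complex mat \<Rightarrow> bool" where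
  "pure_state n n' \<psi> \<longleftrightarrow> \<psi> \<in> carrier_mat n n' \<and> braket n n' \<psi> \<psi> = 1"

definition orthonormal_family :: "nat \<Rightarrow> nat \<Rightarrow> (nat \<Rightarrow> complex vec) \<Rightarrow> bool" where
  "orthonormal_family n r u \<longleftrightarrow>
     (\<forall>i<r. u i \<in> carrier_vec n) \<and>
     (\<forall>i<r. \<forall>j<r. u i \<bullet>c u j = (if i = j then 1 else 0))"

text \<open>
  \<open>|\<psi>\<rangle> = \<Sum>i<r. c\<^sub>i |u\<^sub>i\<rangle>|v\<^sub>i\<rangle>\<close> with orthonormal \<open>u\<^sub>i\<close> and \<open>v\<^sub>i\<close> and strictly positive \<open>c\<^sub>i\<close>. Since only
  the nonzero Schmidt coefficients are listed, \<open>r\<close> is the Schmidt rank of \<open>\<psi>\<close>.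
\<close>

definition schmidt_decomposition ::
  "nat \<Rightarrow> nat \<Rightarrow> complex mat \<Rightarrow> nat \<Rightarrow> (nat \<Rightarrow> real) \<Rightarrow> (nat \<Rightarrow> complex vec) \<Rightarrow> (nat \<Rightarrow> complex vec) \<Rightarrow> bool"
where
  "schmidt_decomposition n n' \<psi> r c u v \<longleftrightarrow>
     (\<forall>i<r. c i > 0) \<and> orthonormal_family n r u \<and> orthonormal_family n' r v \<and>
     \<psi> = mat n n' (\<lambda>(x, y). \<Sum>i<r. complex_of_real (c i) * (u i $ x * v i $ y))"

definition special_entangled :: "nat \<Rightarrow> nat \<Rightarrow> nat \<Rightarrow> complex mat \<Rightarrow> bool" where
  "special_entangled n n' k \<psi> \<longleftrightarrow>
     pure_state n n' \<psi> \<and>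
     (\<exists>c u v. schmidt_decomposition n n' \<psi> k c u v \<and> (\<forall>i<k. c i = 1 / sqrt (real k)))"

definition SUEB :: "nat \<Rightarrow> nat \<Rightarrow> nat \<Rightarrow> nat \<Rightarrow> (nat \<Rightarrow> complex mat) \<Rightarrow> bool" where
  "SUEB n n' k M \<psi> \<longleftrightarrow>
     M < n * n' \<and>
     (\<forall>i\<in>{1..M}. special_entangled n n' k (\<psi> i)) \<and>
     (\<forall>i\<in>{1..M}. \<forall>j\<in>{1..M}. braket n n' (\<psi> i) (\<psi> j) = (if i = j then 1 else 0)) \<and>
     (\<forall>\<phi>. pure_state n n' \<phi> \<longrightarrow> (\<forall>i\<in>{1..M}. braket n n' (\<psi> i) \<phi> = 0) \<longrightarrow>
        \<not> special_entangled n n' k \<phi>)"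

text \<open>
  Square roots of the eigenvalues of \<open>A\<^sup>* A\<close> with algebraic multiplicity. There are \<open>dim_col A\<close> of
  them, so for a wide matrix this differs from the list of \<open>min (dim_row A) (dim_col A)\<close> singular
  values by additional zeros only.
\<close>

definition singular_values :: "complex mat \<Rightarrow> real multiset" where
  "singular_values A = image_mset (\<lambda>z. sqrt (Re z)) (proots (char_poly (mat_adjoint A * A)))"

definition supported_matrices :: "nat \<Rightarrow> nat \<Rightarrow> (nat \<times> nat) set \<Rightarrow> complex mat set" where
  "supported_matrices d d' R =
     {A \<in> carrier_mat d d'. \<forall>x<d. \<forall>y<d'. (x, y) \<notin> R \<longrightarrow> A $$ (x, y) = 0}"

definition orthogonal_basis_of ::
  "nat \<Rightarrow> nat \<Rightarrow> complex mat set \<Rightarrow> nat \<Rightarrow> (nat \<Rightarrow> complex mat) \<Rightarrow> bool"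
where
  "orthogonal_basis_of d d' L N A \<longleftrightarrow>
     (\<forall>i\<in>{1..N}. \<forall>j\<in>{1..N}. i \<noteq> j \<longrightarrow> braket d d' (A i) (A j) = 0) \<and>
     vectorspace.basis class_ring ((module_mat TYPE(complex) d d')\<lparr>carrier := L\<rparr>) (A ` {1..N})"

end

theory Submission
  imports Defs "HOL-Number_Theory.Cong"
begin

text \<open>
  A set of \<open>K\<close> cells of the \<open>n \<times> n'\<close> grid with no two cells in a common line carries \<open>K\<close> orthonormal
  special entangled states of Schmidt number \<open>K\<close>, namely its discrete Fourier basis. So a region
  partitioned into such sets has a basis of special entangled states, and this basis is unextendible
  as soon as the complement of the region is covered by fewer than \<open>K\<close> lines.

  In all four cases \<open>R\<close> is an \<open>a \<times> b\<close> rectangle with \<open>k \<le> a\<close>, \<open>k \<le> b\<close>, \<open>k dvd a * b\<close> and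
  \<open>(d - a) + (d' - b) < k\<close>. Cut the \<open>pd \<times> qd'\<close> grid into \<open>p \<times> q\<close> blocks, keep only the copy of \<open>R\<close> in
  each diagonal block, and keep the other blocks entirely. Both \<open>R\<close> and the full block are partitioned
  into sets of \<open>k\<close> cells as above, and joining equal sets along the cyclic block diagonals gives sets
  of \<open>pk\<close> cells. The removed cells lie on fewer than \<open>pk\<close> lines. By Parseval's identity,
  \<open>N\<close> is the number of cells of \<open>R\<close>.
\<close>

section \<open>Bases of spaces of supported matrices\<close>

lemma braket_eq_sum:
  "braket n n' \<phi> \<psi> = (\<Sum>c\<in>{..<n} \<times> {..<n'}. cnj (\<phi> $$ c) * \<psi> $$ c)"
  by (simp add: braket_def sum.cartesian_product)

lemma braket_add_right:
  assumes "B \<in> carrier_mat n n'" "C \<in> carrier_mat n n'"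
  shows "braket n n' A (B + C) = braket n n' A B + braket n n' A C"
  using assms by (simp add: braket_def sum.distrib distrib_left)

lemma braket_smult_right:
  assumes "B \<in> carrier_mat n n'"
  shows "braket n n' A (a \<cdot>\<^sub>m B) = a * braket n n' A B"
  using assms by (simp add: braket_def sum_distrib_left mult_ac)

lemma braket_zero_right: "braket n n' A (0\<^sub>m n n') = 0"
  by (simp add: braket_def)

lemma submodule_supported_matrices:
  "submodule class_ring (supported_matrices d d' R) (module_mat TYPE(complex) d d')"
proof -
  interpret V: vectorspace class_ring "module_mat TYPE(complex) d d'"
    by (rule matrix_vs)
  show ?thesis
    by unfold_locales (auto simp: supported_matrices_def module_mat_simps class_ring_simps)
qed

lemma vectorspace_supported_matrices:
  "vectorspace class_ring ((module_mat TYPE(complex) d d')\<lparr>carrier := supported_matrices d d' R\<rparr>)"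
proof -
  interpret V: vectorspace class_ring "module_mat TYPE(complex) d d'"
    by (rule matrix_vs)
  show ?thesis
    using V.subspace_is_vs submodule_supported_matrices
    by (simp add: VectorSpace.subspace_def V.vectorspace_axioms)
qed

text \<open>Parseval: expanding the matrix unit of a cell \<open>c\<close> of \<open>R\<close> shows
  that the squared moduli of the entries \<open>A j $$ c\<close> sum to 1 over \<open>j\<close>.
  Summed over all cells this gives \<open>card R\<close>; summed in the other order it gives
  \<open>N\<close>, as each \<open>A j\<close> has norm 1.\<close>

lemma card_orthonormal_basis_supported_matrices:
  assumes R: "R \<subseteq> {..<d} \<times> {..<d'}"
    and on: "\<forall>i\<in>{1..N}. \<forall>j\<in>{1..N}. braket d d' (A i) (A j) = (if i = j then 1 else 0)"
    and basis: "orthogonal_basis_of d d' (supported_matrices d d' R) N A"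
  shows "N = card R"
proof -
  define L where "L = supported_matrices d d' R"
  \<comment> \<open>\<open>W\<close> collects the matrices that equal their own expansion in the
    family \<open>A\<close>. It is a submodule containing the basis, so it contains the whole span
    \<open>L\<close>.\<close>
  define W where "W = {B \<in> L. \<forall>x<d. \<forall>y<d'.
    B $$ (x, y) = (\<Sum>j\<in>{1..N}. braket d d' (A j) B * A j $$ (x, y))}"
  interpret V: vectorspace class_ring "(module_mat TYPE(complex) d d')\<lparr>carrier := L\<rparr>"
    unfolding L_def by (rule vectorspace_supported_matrices)
  have gen: "V.span (A ` {1..N}) = L" and AL: "A ` {1..N} \<subseteq> L"
    using basis unfolding orthogonal_basis_of_def L_def[symmetric] V.basis_def by auto
  have sub: "submodule class_ring W ((module_mat TYPE(complex) d d')\<lparr>carrier := L\<rparr>)"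
  proof unfold_locales
    show "W \<subseteq> carrier ((module_mat TYPE(complex) d d')\<lparr>carrier := L\<rparr>)"
      by (auto simp: W_def)
  next
    fix B C assume "B \<in> W" "C \<in> W"
    moreover from this have "B + C \<in> L" "B \<in> carrier_mat d d'" "C \<in> carrier_mat d d'"
      by (auto simp: W_def L_def supported_matrices_def)
    ultimately show "B \<oplus>\<^bsub>(module_mat TYPE(complex) d d')\<lparr>carrier := L\<rparr>\<^esub> C \<in> W"
      by (auto simp: W_def module_mat_simps braket_add_right sum.distrib distrib_right)
  next
    show "\<zero>\<^bsub>(module_mat TYPE(complex) d d')\<lparr>carrier := L\<rparr>\<^esub> \<in> W"
      by (auto simp: W_def module_mat_simps L_def supported_matrices_def braket_zero_right)
  next
    fix a :: complex and B assume "B \<in> W"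
    moreover from this have "a \<cdot>\<^sub>m B \<in> L" "B \<in> carrier_mat d d'"
      by (auto simp: W_def L_def supported_matrices_def)
    ultimately show "a \<odot>\<^bsub>(module_mat TYPE(complex) d d')\<lparr>carrier := L\<rparr>\<^esub> B \<in> W"
      by (auto simp: W_def module_mat_simps braket_smult_right sum_distrib_left mult.assoc)
  qed
  have "A ` {1..N} \<subseteq> W"
  proof safe
    fix i assume i: "i \<in> {1..N}"
    have "(\<Sum>j\<in>{1..N}. braket d d' (A j) (A i) * z j) = z i" for z :: "nat \<Rightarrow> complex"
    proof -
      have "(\<Sum>j\<in>{1..N}. braket d d' (A j) (A i) * z j) = (\<Sum>j\<in>{1..N}. if j = i then z j else 0)"
        using on i by (intro sum.cong) auto
      then show ?thesis using i by simp
    qed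
    then show "A i \<in> W" using AL i by (auto simp: W_def)
  qed
  then have LW: "L \<subseteq> W"
    using V.span_is_subset[OF _ sub] gen by blast
  have parseval: "(\<Sum>j\<in>{1..N}. cnj (A j $$ c) * A j $$ c) = 1" if c_R: "c \<in> R" for c
  proof -
    obtain x y where c: "c = (x, y)" "x < d" "y < d'" using c_R R by (cases c) auto
    \<comment> \<open>The matrix unit of \<open>c\<close>: its coefficient against \<open>B\<close>
      is the conjugate of \<open>B $$ c\<close>, so its expansion read at \<open>c\<close> is the
      sum of squared moduli.\<close>
    define E :: "complex mat" where "E = mat d d' (\<lambda>c'. if c' = c then 1 else 0)"
    have "E \<in> L" using c_R by (auto simp: E_def L_def supported_matrices_def)
    then have "E \<in> W" using LW by auto
    then have "E $$ (x, y) = (\<Sum>j\<in>{1..N}. braket d d' (A j) E * A j $$ (x, y))"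
      using c by (auto simp: W_def)
    moreover have "braket d d' B E = cnj (B $$ c)" for B
    proof -
      have "braket d d' B E = (\<Sum>c'\<in>{..<d} \<times> {..<d'}. if c' = c then cnj (B $$ c') else 0)"
        unfolding braket_eq_sum by (intro sum.cong) (auto simp: E_def)
      then show ?thesis using c by simp
    qed
    ultimately show ?thesis using c by (simp add: E_def)
  qed
  have "of_nat (card R) = (\<Sum>c\<in>R. \<Sum>j\<in>{1..N}. cnj (A j $$ c) * A j $$ c)"
    using parseval by simp
  also have "\<dots> = (\<Sum>j\<in>{1..N}. \<Sum>c\<in>R. cnj (A j $$ c) * A j $$ c)"
    by (rule sum.swap)
  also have "\<dots> = (\<Sum>j\<in>{1..N}. braket d d' (A j) (A j))"
  proof (rule sum.cong[OF refl])
    fix j assume "j \<in> {1..N}"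
    then have "A j \<in> L" using AL by blast
    then show "(\<Sum>c\<in>R. cnj (A j $$ c) * A j $$ c) = braket d d' (A j) (A j)"
      unfolding braket_eq_sum using R
      by (intro sum.mono_neutral_left) (auto simp: L_def supported_matrices_def)
  qed
  also have "\<dots> = of_nat N" using on by simp
  finally show ?thesis by (metis of_nat_eq_iff)
qed

section \<open>Lines covering a special entangled state\<close>

text \<open>Expanding the squared modulus and summing over \<open>z\<close> first leaves the Gram
  matrix of \<open>u\<close>, which is the identity.\<close>

lemma norm_sq_orthonormal_combination:
  assumes "orthonormal_family n r u"
  shows "(\<Sum>z<n. (cmod (\<Sum>i<r. b i * u i $ z))\<^sup>2) = (\<Sum>i<r. (cmod (b i))\<^sup>2)"
proof -
  have ip: "(\<Sum>z<n. u i $ z * cnj (u j $ z)) = (if i = j then 1 else 0)" if "i < r" "j < r" for i j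
  proof -
    have "dim_vec (u i) = n" "dim_vec (u j) = n"
      using assms that by (auto simp: orthonormal_family_def)
    then have "u i \<bullet>c u j = (\<Sum>z<n. u i $ z * cnj (u j $ z))"
      by (simp add: scalar_prod_def lessThan_atLeast0)
    then show ?thesis using assms that by (simp add: orthonormal_family_def)
  qed
  have "complex_of_real (\<Sum>z<n. (cmod (\<Sum>i<r. b i * u i $ z))\<^sup>2) =
      (\<Sum>z<n. \<Sum>i<r. \<Sum>j<r. b i * cnj (b j) * (u i $ z * cnj (u j $ z)))"
    unfolding of_real_sum complex_norm_square cnj_sum sum_product
    by (simp add: mult_ac)
  also have "\<dots> = (\<Sum>i<r. \<Sum>z<n. \<Sum>j<r. b i * cnj (b j) * (u i $ z * cnj (u j $ z)))"
    by (rule sum.swap)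
  also have "\<dots> = (\<Sum>i<r. \<Sum>j<r. \<Sum>z<n. b i * cnj (b j) * (u i $ z * cnj (u j $ z)))"
    by (intro sum.cong refl sum.swap)
  also have "\<dots> = (\<Sum>i<r. \<Sum>j<r. if i = j then b i * cnj (b j) else 0)"
    by (intro sum.cong refl) (simp add: sum_distrib_left[symmetric] ip)
  also have "\<dots> = complex_of_real (\<Sum>i<r. (cmod (b i))\<^sup>2)"
    by (simp add: complex_norm_square del: of_real_power)
  finally show ?thesis by (simp only: of_real_eq_iff)
qed

text \<open>Bessel for a standard basis vector: \<open>t\<close> is both the \<open>x\<close>-th
  entry and the squared norm of the combination of the \<open>u i\<close> with coefficients
  \<open>cnj (u i $ x)\<close>, hence \<open>t\<^sup>2 \<le> t\<close>.\<close>

lemma bessel_unit_vector: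
  assumes "orthonormal_family n r u" and "x < n"
  shows "(\<Sum>i<r. (cmod (u i $ x))\<^sup>2) \<le> 1"
proof -
  define t where "t = (\<Sum>i<r. (cmod (u i $ x))\<^sup>2)"
  have "(\<Sum>i<r. cnj (u i $ x) * u i $ x) = complex_of_real t"
    by (simp add: t_def complex_norm_square mult.commute del: of_real_power)
  then have "t\<^sup>2 = (cmod (\<Sum>i<r. cnj (u i $ x) * u i $ x))\<^sup>2"
    by simp
  also have "\<dots> \<le> (\<Sum>z<n. (cmod (\<Sum>i<r. cnj (u i $ x) * u i $ z))\<^sup>2)"
    using assms(2) by (intro member_le_sum[where f = "\<lambda>z. (cmod (\<Sum>i<r. cnj (u i $ x) * u i $ z))\<^sup>2"]) auto
  also have "\<dots> = t"
    by (simp add: norm_sq_orthonormal_combination[OF assms(1)] t_def)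
  finally have "t * t \<le> t * 1" by (simp add: power2_eq_square)
  moreover have "t \<ge> 0" by (simp add: t_def sum_nonneg)
  ultimately have "t \<le> 1" unfolding mult_le_cancel_left by linarith
  then show ?thesis by (simp add: t_def)
qed

text \<open>Row \<open>x\<close> is a combination of the \<open>v i\<close> with coefficients
  \<open>c * u i $ x\<close>, so its squared norm is \<open>c\<^sup>2\<close> times a Bessel sum.
  Exchanging \<open>u\<close> and \<open>v\<close> gives the bound for columns.\<close>

lemma norm_sq_row_le:
  assumes "orthonormal_family n r u" "orthonormal_family n' r v" "x < n" "c \<ge> 0"
  shows "(\<Sum>y<n'. (cmod (\<Sum>i<r. complex_of_real c * (u i $ x * v i $ y)))\<^sup>2) \<le> c\<^sup>2"
proof -
  have "(\<Sum>y<n'. (cmod (\<Sum>i<r. complex_of_real c * (u i $ x * v i $ y)))\<^sup>2)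
      = (\<Sum>i<r. (cmod (complex_of_real c * u i $ x))\<^sup>2)"
    using norm_sq_orthonormal_combination[OF assms(2), of "\<lambda>i. complex_of_real c * u i $ x"]
    by (simp add: mult.assoc)
  also have "\<dots> = c\<^sup>2 * (\<Sum>i<r. (cmod (u i $ x))\<^sup>2)"
    by (simp add: norm_mult power_mult_distrib sum_distrib_left)
  also have "\<dots> \<le> c\<^sup>2 * 1"
    by (intro mult_left_mono bessel_unit_vector[OF assms(1,3)]) simp
  finally show ?thesis by simp
qed

text \<open>Every row and every column of a special entangled state of Schmidt number \<open>K\<close> has squared
  norm at most \<open>1 / K\<close>, so fewer than \<open>K\<close> lines cannot carry the total squared norm \<open>1\<close>.\<close>

lemma special_entangled_not_covered:
  assumes special: "special_entangled n n' K \<phi>"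
    and zero: "\<And>x y. x < n \<Longrightarrow> y < n' \<Longrightarrow> x \<notin> X \<Longrightarrow> y \<notin> Y \<Longrightarrow> \<phi> $$ (x, y) = 0"
    and fin: "finite X" "finite Y"
  shows "K \<le> card X + card Y"
proof (cases "K = 0")
  case False
  obtain c u v where sd: "schmidt_decomposition n n' \<phi> K c u v"
    and c: "\<And>i. i < K \<Longrightarrow> c i = 1 / sqrt (real K)"
    and norm: "braket n n' \<phi> \<phi> = 1"
    using special unfolding special_entangled_def pure_state_def by blast
  have u: "orthonormal_family n K u" and v: "orthonormal_family n' K v"
    using sd by (auto simp: schmidt_decomposition_def)
  define e where "e = 1 / sqrt (real K)"
  have e: "e \<ge> 0" "e\<^sup>2 = 1 / real K" by (simp_all add: e_def power_divide)
  have entry: "\<phi> $$ (x, y) = (\<Sum>i<K. complex_of_real e * (u i $ x * v i $ y))"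
    if "x < n" "y < n'" for x y
    using sd that c by (simp add: schmidt_decomposition_def e_def)
  define f where "f x y = (cmod (\<phi> $$ (x, y)))\<^sup>2" for x y
  have f0: "f x y \<ge> 0" for x y by (simp add: f_def)
  have row: "(\<Sum>y<n'. f x y) \<le> 1 / real K" if "x < n" for x
    using norm_sq_row_le[OF u v that e(1)] that by (simp add: f_def entry e(2))
  have col: "(\<Sum>x<n. f x y) \<le> 1 / real K" if "y < n'" for y
    using norm_sq_row_le[OF v u that e(1)] that by (simp add: f_def entry e(2) mult.commute)
  have lines: "(\<Sum>x<m. if x \<in> Z then g x else 0) \<le> real (card Z) / real K"
    if "finite Z" "\<And>x. x < m \<Longrightarrow> g x \<le> 1 / real K" for m Z and g :: "nat \<Rightarrow> real"
  proof -
    have "(\<Sum>x<m. if x \<in> Z then g x else 0) = (\<Sum>x\<in>{..<m} \<inter> Z. g x)"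
      by (simp add: sum.inter_restrict)
    also have "\<dots> \<le> (\<Sum>x\<in>{..<m} \<inter> Z. 1 / real K)"
      using that(2) by (intro sum_mono) auto
    also have "\<dots> \<le> real (card Z) / real K"
      using that(1) by (simp add: divide_right_mono card_mono)
    finally show ?thesis .
  qed
  have "complex_of_real (\<Sum>x<n. \<Sum>y<n'. f x y) = braket n n' \<phi> \<phi>"
    by (simp add: braket_def f_def complex_norm_square mult.commute del: of_real_power)
  then have "1 = (\<Sum>x<n. \<Sum>y<n'. f x y)"
    using norm by (metis of_real_eq_1_iff)
  \<comment> \<open>Every nonzero entry lies on a row of \<open>X\<close> or a column of
    \<open>Y\<close>; one lying on both is counted twice.\<close>
  also have "\<dots> \<le> (\<Sum>x<n. \<Sum>y<n'. (if x \<in> X then f x y else 0) + (if y \<in> Y then f x y else 0))"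
    using f0 zero by (intro sum_mono) (auto simp: f_def)
  also have "\<dots> = (\<Sum>x<n. if x \<in> X then \<Sum>y<n'. f x y else 0) +
      (\<Sum>y<n'. if y \<in> Y then \<Sum>x<n. f x y else 0)"
  proof -
    have "(\<Sum>x<n. \<Sum>y<n'. if y \<in> Y then f x y else 0) = (\<Sum>y<n'. \<Sum>x<n. if y \<in> Y then f x y else 0)"
      by (rule sum.swap)
    also have "\<dots> = (\<Sum>y<n'. if y \<in> Y then \<Sum>x<n. f x y else 0)"
      by (intro sum.cong) auto
    moreover have "(\<Sum>x<n. \<Sum>y<n'. if x \<in> X then f x y else 0) = (\<Sum>x<n. if x \<in> X then \<Sum>y<n'. f x y else 0)"
      by (intro sum.cong) auto
    ultimately show ?thesis by (simp add: sum.distrib)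
  qed
  also have "\<dots> \<le> real (card X) / real K + real (card Y) / real K"
    using lines[OF fin(1) row] lines[OF fin(2) col] by (intro add_mono) auto
  finally have "1 \<le> real (card X + card Y) / real K" by (simp add: add_divide_distrib)
  then show ?thesis using False by (simp add: field_simps del: of_nat_add)
qed simp

section \<open>Fourier states on partial transversals\<close>

definition unity_root :: "nat \<Rightarrow> nat \<Rightarrow> complex" where
  "unity_root K l = cis (2 * pi * real l / real K)"

text \<open>The Fourier matrix is symmetric, so orthogonality of its rows also serves for its
  columns.\<close>

lemma unity_root_power_swap: "unity_root K l ^ i = unity_root K i ^ l"
  by (simp add: unity_root_def DeMoivre mult_ac)

lemma norm_unity_root_power [simp]: "cmod (unity_root K l ^ i) = 1"
  by (simp add: unity_root_def norm_power)

text \<open>For \<open>l \<noteq> m\<close> the quotient \<open>z\<close> of the two roots is a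
  \<open>K\<close>-th root of unity other than 1, so the geometric sum vanishes.\<close>

lemma sum_unity_root_orthogonal:
  assumes "l < K" "m < K"
  shows "(\<Sum>i<K. cnj (unity_root K l ^ i) * unity_root K m ^ i) = (if l = m then of_nat K else 0)"
proof -
  define z where "z = cnj (unity_root K l) * unity_root K m"
  have K: "K > 0" using assms by simp
  have unit: "unity_root K l * cnj (unity_root K l) = 1" for l
    by (simp add: complex_norm_square[symmetric] unity_root_def)
  have sum: "(\<Sum>i<K. cnj (unity_root K l ^ i) * unity_root K m ^ i) = (\<Sum>i<K. z ^ i)"
    by (simp add: z_def power_mult_distrib)
  show ?thesis
  proof (cases "l = m")
    case True
    then have "z = 1" using unit[of m] by (simp add: z_def mult.commute)
    then show ?thesis using True sum by simp
  next
    case False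
    have bij: "bij_betw (unity_root K) {..<K} {z. z ^ K = 1}"
      using bij_betw_roots_unity[OF K] by (simp add: unity_root_def[abs_def])
    have "unity_root K l \<noteq> unity_root K m"
      using False assms bij by (auto simp: bij_betw_def inj_on_def)
    moreover have "unity_root K l * z = unity_root K m"
      using unit[of l] by (simp add: z_def mult.assoc[symmetric])
    ultimately have "z \<noteq> 1" by auto
    moreover have "unity_root K j ^ K = 1" if "j < K" for j
      using bij that by (auto simp: bij_betw_def)
    then have "z ^ K = 1"
      using assms
      by (simp add: z_def power_mult_distrib complex_cnj_power[symmetric] del: complex_cnj_power)
    ultimately show ?thesis using False sum by (simp add: geometric_sum)
  qed
qed

definition partial_transversal :: "(nat \<times> nat) set \<Rightarrow> bool" where
  "partial_transversal T \<longleftrightarrow> inj_on fst T \<and> inj_on snd T"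

text \<open>\<open>r\<close> is meant to number the cells of \<open>T\<close> from 0 to
  \<open>K - 1\<close>; row \<open>l\<close> of the unitary Fourier matrix of order \<open>K\<close>
  is then spread over \<open>T\<close>.\<close>

definition fourier_state ::
  "nat \<Rightarrow> nat \<Rightarrow> nat \<Rightarrow> (nat \<times> nat) set \<Rightarrow> (nat \<times> nat \<Rightarrow> nat) \<Rightarrow> nat \<Rightarrow> complex mat"
where
  "fourier_state n n' K T r l =
     mat n n' (\<lambda>c. if c \<in> T then unity_root K l ^ r c / complex_of_real (sqrt (real K)) else 0)"

lemma braket_fourier_state:
  assumes "T \<subseteq> {..<n} \<times> {..<n'}"
  shows "braket n n' (fourier_state n n' K T r l) \<phi> =
    (\<Sum>c\<in>T. cnj (unity_root K l ^ r c) * \<phi> $$ c) / complex_of_real (sqrt (real K))"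
proof -
  have "braket n n' (fourier_state n n' K T r l) \<phi> =
      (\<Sum>c\<in>T. cnj (unity_root K l ^ r c / complex_of_real (sqrt (real K))) * \<phi> $$ c)"
    unfolding braket_eq_sum
    by (rule sum.mono_neutral_cong_right) (use assms in \<open>auto simp: fourier_state_def\<close>)
  then show ?thesis by (simp add: sum_divide_distrib)
qed

lemma braket_fourier_state_same:
  assumes T: "T \<subseteq> {..<n} \<times> {..<n'}" and r: "bij_betw r T {..<K}" and "l < K" "m < K"
  shows "braket n n' (fourier_state n n' K T r l) (fourier_state n n' K T r m) =
    (if l = m then 1 else 0)"
proof -
  have "(\<Sum>c\<in>T. cnj (unity_root K l ^ r c) * fourier_state n n' K T r m $$ c) =
      (\<Sum>c\<in>T. cnj (unity_root K l ^ r c) * unity_root K m ^ r c / complex_of_real (sqrt (real K)))"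
    using T by (intro sum.cong) (auto simp: fourier_state_def)
  also have "\<dots> = (\<Sum>i<K. cnj (unity_root K l ^ i) * unity_root K m ^ i / complex_of_real (sqrt (real K)))"
    by (rule sum.reindex_bij_betw[OF r])
  also have "\<dots> = (if l = m then of_nat K else 0) / complex_of_real (sqrt (real K))"
    by (simp only: sum_divide_distrib[symmetric] sum_unity_root_orthogonal[OF assms(3,4)])
  finally have "braket n n' (fourier_state n n' K T r l) (fourier_state n n' K T r m) =
      (if l = m then of_nat K else 0) / (complex_of_real (sqrt (real K)) * complex_of_real (sqrt (real K)))"
    by (simp add: braket_fourier_state[OF T])
  also have "complex_of_real (sqrt (real K)) * complex_of_real (sqrt (real K)) = of_nat K"
    by (simp add: of_real_mult[symmetric] del: of_real_mult)
  finally show ?thesis using assms(3) by simp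
qed

lemma braket_fourier_state_disjoint:
  assumes "T \<subseteq> {..<n} \<times> {..<n'}" and "T \<inter> T' = {}"
  shows "braket n n' (fourier_state n n' K T r l) (fourier_state n n' K T' r' m) = 0"
proof -
  have "fourier_state n n' K T' r' m $$ c = 0" if "c \<in> T" for c
  proof -
    have "c \<in> {..<n} \<times> {..<n'}" "c \<notin> T'" using that assms by auto
    then show ?thesis by (cases c) (simp add: fourier_state_def)
  qed
  then show ?thesis by (simp add: braket_fourier_state[OF assms(1)])
qed

text \<open>Fourier inversion on \<open>T\<close>: weighting the \<open>l\<close>-th relation by
  \<open>unity_root K l ^ r c\<close> and summing over \<open>l\<close> isolates
  \<open>\<phi> $$ c\<close>, because distinct columns of the Fourier matrix are orthogonal.\<close>

lemma orthogonal_fourier_states_imp_zero: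
  assumes T: "T \<subseteq> {..<n} \<times> {..<n'}" and r: "bij_betw r T {..<K}"
    and orth: "\<And>l. l < K \<Longrightarrow> braket n n' (fourier_state n n' K T r l) \<phi> = 0"
    and c: "c \<in> T"
  shows "\<phi> $$ c = 0"
proof -
  have rK: "r t < K" if "t \<in> T" for t using r that by (auto simp: bij_betw_def)
  have inj: "inj_on r T" and fin: "finite T"
    using r bij_betw_finite by (auto simp: bij_betw_def)
  have K: "K > 0" using rK[OF c] by simp
  have 0: "(\<Sum>t\<in>T. cnj (unity_root K l ^ r t) * \<phi> $$ t) = 0" if "l < K" for l
    using orth[OF that] K by (simp add: braket_fourier_state[OF T])
  have "0 = (\<Sum>l<K. unity_root K l ^ r c * (\<Sum>t\<in>T. cnj (unity_root K l ^ r t) * \<phi> $$ t))"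
    by (simp add: 0 del: complex_cnj_power)
  also have "\<dots> = (\<Sum>t\<in>T. \<Sum>l<K. cnj (unity_root K l ^ r t) * unity_root K l ^ r c * \<phi> $$ t)"
    unfolding sum_distrib_left by (subst sum.swap) (simp add: mult_ac)
  also have "\<dots> = (\<Sum>t\<in>T. (\<Sum>l<K. cnj (unity_root K (r t) ^ l) * unity_root K (r c) ^ l) * \<phi> $$ t)"
    by (simp only: sum_distrib_right unity_root_power_swap[of K _ "r _"])
  also have "\<dots> = (\<Sum>t\<in>T. if t = c then of_nat K * \<phi> $$ t else 0)"
    using inj c
    by (intro sum.cong refl)
      (simp add: sum_unity_root_orthogonal rK inj_on_eq_iff del: complex_cnj_power)
  also have "\<dots> = of_nat K * \<phi> $$ c" using c fin by simp
  finally show ?thesis using K by simp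
qed

lemma orthonormal_family_unit_vectors:
  assumes "\<And>i. i < r \<Longrightarrow> g i < n" "inj_on g {..<r}" "\<And>i. i < r \<Longrightarrow> cmod (h i) = 1"
  shows "orthonormal_family n r (\<lambda>i. vec n (\<lambda>x. if x = g i then h i else 0))"
  unfolding orthonormal_family_def
proof (intro conjI allI impI)
  fix i j assume ij: "i < r" "j < r"
  have "vec n (\<lambda>x. if x = g i then h i else 0) \<bullet>c vec n (\<lambda>x. if x = g j then h j else 0) =
      (\<Sum>x\<in>{0..<n}. if x = g i then (if i = j then h i * cnj (h i) else 0) else 0)"
    unfolding scalar_prod_def
    by (rule sum.cong) (use assms(2) ij in \<open>auto simp: inj_on_def\<close>)
  also have "\<dots> = (if i = j then 1 else 0)"
    using assms(1,3) ij by (simp add: complex_norm_square[symmetric])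
  finally show "vec n (\<lambda>x. if x = g i then h i else 0) \<bullet>c vec n (\<lambda>x. if x = g j then h j else 0) =
      (if i = j then 1 else 0)" .
qed simp

text \<open>Since no two cells of \<open>T\<close> share a line, the cells themselves give a Schmidt
  decomposition, with standard basis vectors (up to phases) for their rows and columns.\<close>

lemma special_entangled_fourier_state:
  assumes T: "T \<subseteq> {..<n} \<times> {..<n'}" and r: "bij_betw r T {..<K}"
    and trans: "partial_transversal T" and l: "l < K"
  shows "special_entangled n n' K (fourier_state n n' K T r l)"
proof -
  define e where "e = inv_into T r"
  have e: "bij_betw e {..<K} T" unfolding e_def by (rule bij_betw_inv_into[OF r])
  have er: "e (r t) = t" if "t \<in> T" for t
    using r that by (simp add: e_def bij_betw_inv_into_left)
  have eT: "e i \<in> T" if "i < K" for i using e that by (auto simp: bij_betw_def)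
  have fin: "finite T" using r bij_betw_finite by blast
  \<comment> \<open>Schmidt coefficients must be positive reals, so the phase is absorbed into the
    left vector.\<close>
  define u where "u i = vec n (\<lambda>x. if x = fst (e i) then unity_root K l ^ i else 0)" for i
  define v where "v i = vec n' (\<lambda>y. if y = snd (e i) then 1 else 0 :: complex)" for i
  have inj: "inj_on (fst \<circ> e) {..<K}" "inj_on (snd \<circ> e) {..<K}"
    using trans e by (auto simp: partial_transversal_def bij_betw_def intro!: comp_inj_on)
  have lt: "fst (e i) < n" "snd (e i) < n'" if "i < K" for i
    using eT[OF that] T by auto
  have u: "orthonormal_family n K u"
    unfolding u_def using inj lt by (intro orthonormal_family_unit_vectors) (auto simp: comp_def)
  have v: "orthonormal_family n' K v"
    unfolding v_def using inj lt by (intro orthonormal_family_unit_vectors) (auto simp: comp_def)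
  have "(\<Sum>i<K. complex_of_real (1 / sqrt (real K)) * (u i $ x * v i $ y)) =
      (if (x, y) \<in> T then unity_root K l ^ r (x, y) / complex_of_real (sqrt (real K)) else 0)"
    if "x < n" "y < n'" for x y
  proof -
    have "(\<Sum>i<K. complex_of_real (1 / sqrt (real K)) * (u i $ x * v i $ y)) =
        (\<Sum>i<K. if e i = (x, y) then unity_root K l ^ i / complex_of_real (sqrt (real K)) else 0)"
      using that by (intro sum.cong) (auto simp: u_def v_def prod_eq_iff)
    also have "\<dots> = (\<Sum>t\<in>T. if e (r t) = (x, y) then unity_root K l ^ r t / complex_of_real (sqrt (real K)) else 0)"
      by (rule sum.reindex_bij_betw[OF r, symmetric])
    also have "\<dots> = (\<Sum>t\<in>T. if t = (x, y) then unity_root K l ^ r t / complex_of_real (sqrt (real K)) else 0)"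
      by (intro sum.cong) (auto simp: er)
    finally show ?thesis using fin by simp
  qed
  then have "fourier_state n n' K T r l =
      mat n n' (\<lambda>(x, y). \<Sum>i<K. complex_of_real (1 / sqrt (real K)) * (u i $ x * v i $ y))"
    by (intro eq_matI) (auto simp: fourier_state_def)
  then have "schmidt_decomposition n n' (fourier_state n n' K T r l) K (\<lambda>_. 1 / sqrt (real K)) u v"
    using u v l by (simp add: schmidt_decomposition_def)
  moreover have "pure_state n n' (fourier_state n n' K T r l)"
    using braket_fourier_state_same[OF T r l l] by (simp add: pure_state_def fourier_state_def)
  ultimately show ?thesis unfolding special_entangled_def by blast
qed

section \<open>From a tiling to an unextendible basis\<close>

definition tiled :: "nat \<Rightarrow> (nat \<times> nat) set \<Rightarrow> bool" where
  "tiled K S \<longleftrightarrow> (\<exists>P. pairwise disjnt P \<and> \<Union>P = S \<and>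
     (\<forall>T\<in>P. finite T \<and> card T = K \<and> partial_transversal T))"

text \<open>The Fourier states of all tiles form an orthonormal basis of the matrices supported on
  \<open>S\<close>. A state orthogonal to them vanishes on \<open>S\<close>, so the fewer than
  \<open>K\<close> lines in \<open>X\<close> and \<open>Y\<close> cover it, which is impossible for
  Schmidt number \<open>K\<close>.\<close>

lemma SUEB_of_tiled:
  assumes tiled: "tiled K S" and S: "S \<subseteq> {..<n} \<times> {..<n'}" and M: "card S < n * n'"
    and cover: "\<And>x y. x < n \<Longrightarrow> y < n' \<Longrightarrow> (x, y) \<notin> S \<Longrightarrow> x \<in> X \<or> y \<in> Y"
    and fin: "finite X" "finite Y" and few: "card X + card Y < K"
  shows "\<exists>\<Psi>. SUEB n n' K (card S) \<Psi>"
proof -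
  obtain P where disj: "pairwise disjnt P" and PS: "\<Union>P = S"
    and P: "\<And>T. T \<in> P \<Longrightarrow> finite T \<and> card T = K \<and> partial_transversal T"
    using tiled by (auto simp: tiled_def)
  have finS: "finite S" using S finite_subset by blast
  have finP: "finite P" using PS finS by (simp add: finite_UnionD)
  have sub: "T \<subseteq> {..<n} \<times> {..<n'}" if "T \<in> P" for T using that PS S by blast
  have "card S = (\<Sum>T\<in>P. card T)"
    using disj P unfolding PS[symmetric]
    by (intro card_Union_disjoint) (auto simp: pairwise_def disjnt_def)
  then have "card S = card (P \<times> {..<K})" using P by (simp add: card_cartesian_product)
  \<comment> \<open>States are indexed by a tile and a frequency; \<open>h\<close> numbers these
    pairs from 1, as \<open>SUEB\<close> does.\<close>
  then obtain h where h: "bij_betw h {1..card S} (P \<times> {..<K})"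
    using finP by (metis finite_same_card_bij finite_atLeastAtMost card_atLeastAtMost
        diff_Suc_1 finite_cartesian_product finite_lessThan One_nat_def)
  have "\<exists>r. bij_betw r T {..<K}" if "T \<in> P" for T
    using P[OF that] by (intro finite_same_card_bij) auto
  then obtain r where r: "\<And>T. T \<in> P \<Longrightarrow> bij_betw (r T) T {..<K}" by metis
  define F where "F = (\<lambda>(T, l). fourier_state n n' K T (r T) l)"
  define \<Psi> where "\<Psi> i = F (h i)" for i
  have hP: "h i \<in> P \<times> {..<K}" if "i \<in> {1..card S}" for i
    using h that by (rule bij_betw_apply)
  have on: "braket n n' (F a) (F b) = (if a = b then 1 else 0)"
    if ab_in: "a \<in> P \<times> {..<K}" "b \<in> P \<times> {..<K}" for a b
  proof -
    obtain T l T' m where ab: "a = (T, l)" "b = (T', m)" "T \<in> P" "T' \<in> P" "l < K" "m < K"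
      using ab_in by auto
    show ?thesis
    proof (cases "T = T'")
      case True
      then show ?thesis
        using braket_fourier_state_same[OF sub r] ab by (simp add: F_def)
    next
      case False
      then have "T \<inter> T' = {}" using disj ab by (auto simp: pairwise_def disjnt_def)
      then show ?thesis
        using braket_fourier_state_disjoint[OF sub] ab False by (simp add: F_def)
    qed
  qed
  have "SUEB n n' K (card S) \<Psi>"
    unfolding SUEB_def
  proof (intro conjI ballI allI impI)
    show "card S < n * n'" by (rule M)
  next
    fix i assume "i \<in> {1..card S}"
    then show "special_entangled n n' K (\<Psi> i)"
      using hP[of i] special_entangled_fourier_state[OF sub r] P
      by (auto simp: \<Psi>_def F_def split: prod.splits)
  next
    fix i j assume ij: "i \<in> {1..card S}" "j \<in> {1..card S}"
    then have "h i = h j \<longleftrightarrow> i = j" using h by (auto simp: bij_betw_def inj_on_eq_iff)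
    then show "braket n n' (\<Psi> i) (\<Psi> j) = (if i = j then 1 else 0)"
      using on[OF hP hP, OF ij] by (simp add: \<Psi>_def)
  next
    fix \<phi> assume orth: "\<forall>i\<in>{1..card S}. braket n n' (\<Psi> i) \<phi> = 0"
    have "braket n n' (fourier_state n n' K T (r T) l) \<phi> = 0" if "T \<in> P" "l < K" for T l
    proof -
      have "(T, l) \<in> h ` {1..card S}" using that h by (simp add: bij_betw_def)
      then obtain i where "i \<in> {1..card S}" "h i = (T, l)" by auto
      then show ?thesis using orth by (force simp: \<Psi>_def F_def)
    qed
    then have "\<phi> $$ c = 0" if "c \<in> S" for c
      using that orthogonal_fourier_states_imp_zero[OF sub r] unfolding PS[symmetric] by blast
    then have "\<phi> $$ (x, y) = 0" if "x < n" "y < n'" "x \<notin> X" "y \<notin> Y" for x y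
      using that cover by blast
    then show "\<not> special_entangled n n' K \<phi>"
      using special_entangled_not_covered[OF _ _ fin] few by (metis not_le)
  qed
  then show ?thesis by blast
qed

section \<open>Tilings by partial transversals\<close>

lemma tiled_UN:
  assumes "\<And>m. m \<in> I \<Longrightarrow> tiled K (S m)" "disjoint_family_on S I"
  shows "tiled K (\<Union>m\<in>I. S m)"
proof -
  obtain P where P: "\<And>m. m \<in> I \<Longrightarrow> pairwise disjnt (P m) \<and> \<Union>(P m) = S m \<and>
     (\<forall>T\<in>P m. finite T \<and> card T = K \<and> partial_transversal T)"
    using assms(1) unfolding tiled_def by metis
  have "disjnt T T'" if "m \<in> I" "m' \<in> I" "T \<in> P m" "T' \<in> P m'" "T \<noteq> T'" for m m' T T'
  proof (cases "m = m'")
    case True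
    then show ?thesis using P[OF that(1)] that by (auto simp: pairwise_def)
  next
    case False
    have "T \<subseteq> S m" "T' \<subseteq> S m'" using P that by blast+
    then show ?thesis
      using assms(2) that False unfolding disjoint_family_on_def disjnt_def by blast
  qed
  then have "pairwise disjnt (\<Union>m\<in>I. P m)" by (auto simp: pairwise_def)
  moreover have "\<Union>(\<Union>m\<in>I. P m) = (\<Union>m\<in>I. \<Union>(P m))" by blast
  then have "\<Union>(\<Union>m\<in>I. P m) = (\<Union>m\<in>I. S m)" using P by simp
  moreover have "\<forall>T\<in>(\<Union>m\<in>I. P m). finite T \<and> card T = K \<and> partial_transversal T"
    using P by blast
  ultimately show ?thesis unfolding tiled_def by blast
qed

text \<open>Serves both transposition and block copying: each tile \<open>T\<close> becomes the
  image of \<open>I \<times> T\<close>, and injectivity of \<open>g\<close> keeps the new tiles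
  disjoint and multiplies their size by \<open>card I\<close>.\<close>

lemma tiled_by_images:
  assumes "tiled k S" and inj: "inj_on g (I \<times> S)" and "finite I"
    and trans: "\<And>T. T \<subseteq> S \<Longrightarrow> partial_transversal T \<Longrightarrow> partial_transversal (g ` (I \<times> T))"
  shows "tiled (card I * k) (g ` (I \<times> S))"
proof -
  obtain P where disj: "pairwise disjnt P" and PS: "\<Union>P = S"
    and P: "\<And>T. T \<in> P \<Longrightarrow> finite T \<and> card T = k \<and> partial_transversal T"
    using assms(1) by (auto simp: tiled_def)
  have sub: "I \<times> T \<subseteq> I \<times> S" if "T \<in> P" for T using that PS by blast
  show ?thesis
    unfolding tiled_def
  proof (intro exI[of _ "(\<lambda>T. g ` (I \<times> T)) ` P"] conjI ballI)
    have "g ` (I \<times> T) \<inter> g ` (I \<times> T') = {}" if "T \<in> P" "T' \<in> P" "T \<noteq> T'" for T T'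
    proof -
      have "g ` (I \<times> T) \<inter> g ` (I \<times> T') = g ` ((I \<times> T) \<inter> (I \<times> T'))"
        using inj_on_image_Int[OF inj] sub that by blast
      moreover have "T \<inter> T' = {}" using disj that by (auto simp: pairwise_def disjnt_def)
      ultimately show ?thesis by blast
    qed
    then show "pairwise disjnt ((\<lambda>T. g ` (I \<times> T)) ` P)"
      by (auto simp: pairwise_def disjnt_def)
    show "\<Union> ((\<lambda>T. g ` (I \<times> T)) ` P) = g ` (I \<times> S)"
      unfolding PS[symmetric] by blast
  next
    fix U assume "U \<in> (\<lambda>T. g ` (I \<times> T)) ` P"
    then obtain T where T: "T \<in> P" "U = g ` (I \<times> T)" by blast
    then show "finite U" using P assms(3) by auto
    show "card U = card I * k"
      using T P card_image[OF inj_on_subset[OF inj sub]] by (simp add: card_cartesian_product)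
    show "partial_transversal U" using T trans P PS by blast
  qed
qed

lemma tiled_swap:
  assumes "tiled k S"
  shows "tiled k (prod.swap ` S)"
proof -
  \<comment> \<open>A single copy, indexed by the one element of the unit type.\<close>
  have "tiled (card {()} * k) ((\<lambda>(_, c). prod.swap c) ` ({()} \<times> S))"
    using assms
    by (rule tiled_by_images) (auto simp: inj_on_def partial_transversal_def)
  moreover have "(\<lambda>(_, c). prod.swap c) ` ({()} \<times> S) = prod.swap ` S" by force
  ultimately show ?thesis by simp
qed

section \<open>Copying a tiling into blocks of a larger grid\<close>

lemma mult_add_eq_iff:
  fixes a b d x y :: nat
  assumes "x < d" "y < d"
  shows "a * d + x = b * d + y \<longleftrightarrow> a = b \<and> x = y"
proof
  assume eq: "a * d + x = b * d + y"
  have "(a * d + x) div d = a" "(b * d + y) div d = b" using assms by auto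
  then show "a = b \<and> x = y" using eq by auto
qed simp

text \<open>\<open>a\<close> is the block row and \<open>\<sigma>\<close> selects its block column,
  so each block row contributes one block.\<close>

definition block_cell :: "nat \<Rightarrow> nat \<Rightarrow> (nat \<Rightarrow> nat) \<Rightarrow> nat \<times> nat \<times> nat \<Rightarrow> nat \<times> nat" where
  "block_cell d d' \<sigma> = (\<lambda>(a, x, y). (a * d + x, \<sigma> a * d' + y))"

lemma inj_on_block_cell:
  assumes "S \<subseteq> {..<d} \<times> {..<d'}"
  shows "inj_on (block_cell d d' \<sigma>) (I \<times> S)"
proof (rule inj_onI)
  fix c c' assume c: "c \<in> I \<times> S" "c' \<in> I \<times> S" "block_cell d d' \<sigma> c = block_cell d d' \<sigma> c'"
  obtain a x y a' x' y' where eq: "c = (a, x, y)" "c' = (a', x', y')" by (metis prod.exhaust)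
  have "x < d" "x' < d" "y < d'" "y' < d'" using c eq assms by auto
  then show "c = c'" using c(3) eq by (auto simp: block_cell_def mult_add_eq_iff)
qed

text \<open>Blocks chosen by an injective \<open>\<sigma>\<close> share neither block row nor block
  column, so the \<open>p\<close> copies of one tile together still repeat no line.\<close>

lemma tiled_blocks:
  assumes S: "S \<subseteq> {..<d} \<times> {..<d'}" and "tiled k S" and \<sigma>: "inj_on \<sigma> {..<p}"
  shows "tiled (p * k) (block_cell d d' \<sigma> ` ({..<p} \<times> S))"
proof -
  have "tiled (card {..<p} * k) (block_cell d d' \<sigma> ` ({..<p} \<times> S))"
  proof (rule tiled_by_images[OF assms(2)])
    show "inj_on (block_cell d d' \<sigma>) ({..<p} \<times> S)" by (rule inj_on_block_cell[OF S])
  next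
    fix T assume T: "T \<subseteq> S" "partial_transversal T"
    have lt: "x < d \<and> y < d'" if "(x, y) \<in> T" for x y using that T S by auto
    have "(x, y) = (x', y')" if "(x, y) \<in> T" "(x', y') \<in> T" "x = x' \<or> y = y'" for x y x' y'
      using T(2) that unfolding partial_transversal_def inj_on_def by (metis fst_conv snd_conv)
    then show "partial_transversal (block_cell d d' \<sigma> ` ({..<p} \<times> T))"
      unfolding partial_transversal_def using \<sigma> lt
      by (fastforce simp: block_cell_def inj_on_def mult_add_eq_iff)
  qed simp
  then show ?thesis by simp
qed

text \<open>Listing the cells along the successive cyclic diagonals of the rectangle, any \<open>k\<close> consecutive
  cells starting at a multiple of \<open>k\<close> meet at most two diagonals and never repeat a line.\<close>

lemma tiled_wide_rectangle:
  assumes "0 < k" "k \<le> a" "a \<le> b" "k dvd a * b"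
  shows "tiled k ({..<a} \<times> {..<b})"
proof -
  \<comment> \<open>Cell \<open>n\<close> is in row \<open>n mod a\<close> of the cyclic diagonal
    numbered \<open>n div a\<close>; \<open>J j\<close> is the \<open>j\<close>-th run of
    \<open>k\<close> consecutive cells.\<close>
  define f where "f n = (n mod a, (n mod a + n div a) mod b)" for n
  define J where "J j = {j * k..<j * k + k}" for j
  obtain M where M: "a * b = M * k" using assms(4) by (metis dvdE mult.commute)
  have a: "a > 0" "b > 0" using assms by auto
  have divlt: "n div a < b" if "n < a * b" for n
    using that by (simp add: less_mult_imp_div_less mult.commute)
  have inj: "inj_on f {..<a * b}"
  proof (rule inj_onI)
    fix n m assume nm: "n \<in> {..<a * b}" "m \<in> {..<a * b}" "f n = f m"
    then have 1: "n mod a = m mod a" and "(n mod a + n div a) mod b = (n mod a + m div a) mod b"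
      by (auto simp: f_def)
    then have "[n mod a + n div a = n mod a + m div a] (mod b)" by (simp add: cong_def)
    then have "[n div a = m div a] (mod b)" by (simp add: cong_add_lcancel_nat)
    then have "n div a = m div a" using divlt nm by (simp add: cong_def)
    then show "n = m" using 1 by (metis div_mult_mod_eq)
  qed
  have "f ` {..<a * b} = {..<a} \<times> {..<b}"
  proof (rule card_subset_eq)
    show "f ` {..<a * b} \<subseteq> {..<a} \<times> {..<b}" using a by (auto simp: f_def)
    show "card (f ` {..<a * b}) = card ({..<a} \<times> {..<b})" using inj by (simp add: card_image)
  qed simp
  moreover have "(\<Union>j<M. J j) = {..<a * b}"
  proof
    show "(\<Union>j<M. J j) \<subseteq> {..<a * b}"
    proof
      fix n assume "n \<in> (\<Union>j<M. J j)"
      then obtain j where j: "j < M" "n < j * k + k" by (auto simp: J_def)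
      have "Suc j * k \<le> M * k" using j by (intro mult_right_mono) auto
      then show "n \<in> {..<a * b}" using j M by simp
    qed
    show "{..<a * b} \<subseteq> (\<Union>j<M. J j)"
    proof
      fix n assume "n \<in> {..<a * b}"
      then have "n div k < M" using M by (simp add: less_mult_imp_div_less)
      moreover have "n \<in> J (n div k)"
        using assms(1) by (simp add: J_def) (metis add.commute add_less_cancel_left div_mult_mod_eq mod_less_divisor)
      ultimately show "n \<in> (\<Union>j<M. J j)" by blast
    qed
  qed
  ultimately have un: "\<Union>((\<lambda>j. f ` J j) ` {..<M}) = {..<a} \<times> {..<b}"
    and Jsub: "\<And>j. j < M \<Longrightarrow> J j \<subseteq> {..<a * b}" by blast+
  have Jdisj: "J i \<inter> J j = {}" if "i \<noteq> j" for i j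
  proof -
    have "n div k = j" if "n \<in> J j" for n j
    proof -
      have "n = j * k + (n - j * k)" "n - j * k < k" using that by (auto simp: J_def)
      then show ?thesis
        by (metis add_cancel_right_right div_less div_mult_self3 assms(1) less_numeral_extra(3))
    qed
    then show ?thesis using that by blast
  qed
  \<comment> \<open>Two cells of one run are less than \<open>k \<le> a\<close> apart, so
    \<open>m\<close> lies on the diagonal of \<open>n\<close> or on the next one.\<close>
  have line: "n mod a \<noteq> m mod a \<and> (n mod a + n div a) mod b \<noteq> (m mod a + m div a) mod b"
    if "n \<in> J j" "m \<in> J j" "n < m" for n m j
  proof -
    have nm: "j * k \<le> n" "m < j * k + k" using that by (auto simp: J_def)
    define s where "s = m - n"
    have s: "m = n + s" "0 < s" "s < k" using that nm by (auto simp: s_def)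
    show ?thesis
    proof (cases "n mod a + s < a")
      \<comment> \<open>Same diagonal: row and column both advance by \<open>s\<close>, the column
        cyclically, and \<open>0 < s < b\<close>.\<close>
      case True
      have "m = n mod a + s + n div a * a" using s by simp
      then have md: "m div a = n div a" "m mod a = n mod a + s"
        using True a by (metis div_less div_mult_self1 add.right_neutral add_0 not_less0,
          metis mod_mult_self1 mod_less True)
      have "\<not> [n mod a + n div a = n mod a + n div a + s] (mod b)"
      proof
        assume "[n mod a + n div a = n mod a + n div a + s] (mod b)"
        then have "[0 = s] (mod b)"
          by (metis add.right_neutral cong_add_lcancel_nat)
        then show False using s assms by (auto simp: cong_def)
      qed
      then show ?thesis using s md by (auto simp: cong_def add_ac)
    next
      case False
      \<comment> \<open>\<open>m\<close> has passed to row \<open>t\<close> of the next diagonal,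
        whose columns are shifted by one. So the columns agree exactly when \<open>Suc t\<close> and
        \<open>n mod a\<close> are congruent modulo \<open>b\<close>.\<close>
      define t where "t = n mod a + s - a"
      have t: "n mod a + s = a + t" using False by (simp add: t_def)
      have na: "n mod a < a" using a by simp
      have ta: "t < a" "t < n mod a" using t na s assms by linarith+
      have "m = t + Suc (n div a) * a"
        using s(1) t div_mult_mod_eq[of n a] unfolding mult_Suc by linarith
      then have md: "m div a = Suc (n div a)" "m mod a = t"
        using ta(1) by (simp_all only: div_mult_self1 mod_mult_self1) (use a in simp_all)
      \<comment> \<open>Here the alignment of the runs matters: equality would make the run a
        complete diagonal with \<open>n\<close> as its first cell, so \<open>n mod a\<close> would
        be 0, against \<open>t < n mod a\<close>.\<close>
      have "Suc t \<noteq> n mod a"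
      proof
        assume "Suc t = n mod a"
        then have "Suc s = a" using t by simp
        then have ka: "k = a" and sk: "s = k - 1" using s assms by auto
        then have "n = j * a" using nm s by simp
        then have "n mod a = 0" by simp
        then show False using ta by simp
      qed
      then have lt: "Suc t < n mod a" using ta by simp
      \<comment> \<open>The difference of the two columns before reduction modulo \<open>b\<close>;
        it lies strictly between 0 and \<open>b\<close>.\<close>
      define v where "v = n mod a - Suc t"
      have v: "n mod a = Suc t + v" "0 < v" "v < b" using lt na assms(3) unfolding v_def by linarith+
      have "\<not> [Suc t + n div a + v = Suc t + n div a + 0] (mod b)"
      proof
        assume "[Suc t + n div a + v = Suc t + n div a + 0] (mod b)"
        then have "[v = 0] (mod b)" by (simp only: cong_add_lcancel_nat)
        then show False using v by (auto simp: cong_def)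
      qed
      then show ?thesis using v ta md by (auto simp: cong_def add_ac)
    qed
  qed
  have line': "n mod a \<noteq> m mod a \<and> (n mod a + n div a) mod b \<noteq> (m mod a + m div a) mod b"
    if "n \<in> J j" "m \<in> J j" "n \<noteq> m" for n m j
    using line[of n j m] line[of m j n] that by (metis linorder_neqE_nat)
  show ?thesis
    unfolding tiled_def
  proof (intro exI[of _ "(\<lambda>j. f ` J j) ` {..<M}"] conjI ballI)
    have "f ` J i \<inter> f ` J j = {}" if "i < M" "j < M" "i \<noteq> j" for i j
      using inj_on_image_Int[OF inj Jsub Jsub] Jdisj that by (metis image_empty)
    then show "pairwise disjnt ((\<lambda>j. f ` J j) ` {..<M})"
      unfolding pairwise_image by (auto simp: pairwise_def disjnt_def)
    show "\<Union>((\<lambda>j. f ` J j) ` {..<M}) = {..<a} \<times> {..<b}" by (rule un)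
  next
    fix T assume "T \<in> (\<lambda>j. f ` J j) ` {..<M}"
    then obtain j where j: "j < M" "T = f ` J j" by blast
    show "finite T" using j by (simp add: J_def)
    have "card T = card (J j)"
      using j card_image[OF inj_on_subset[OF inj Jsub]] by simp
    then show "card T = k" by (simp add: J_def)
    show "partial_transversal T"
      unfolding partial_transversal_def j(2) inj_on_def
      using line'[of _ j] by (auto simp: f_def)
  qed
qed

lemma tiled_rectangle:
  assumes "0 < k" "k \<le> a" "k \<le> b" "k dvd a * b"
  shows "tiled k ({..<a} \<times> {..<b})"
proof (cases "a \<le> b")
  case True
  then show ?thesis using tiled_wide_rectangle assms by blast
next
  case False
  then have "tiled k ({..<b} \<times> {..<a})"
    using tiled_wide_rectangle[of k b a] assms by (simp add: mult.commute)
  then have "tiled k (prod.swap ` ({..<b} \<times> {..<a}))" by (rule tiled_swap)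
  then show ?thesis by (simp add: product_swap)
qed

section \<open>The block construction\<close>

text \<open>The \<open>q\<close> cyclic block diagonals, each of \<open>p\<close> blocks, partition
  the large grid. Only diagonal 0 is thinned, which removes \<open>p * (d * d' - a * b)\<close>
  cells on at most \<open>p * ((d - a) + (d' - b))\<close> lines.\<close>

lemma SUEB_of_rectangle:
  assumes k: "1 \<le> k" "k \<le> d" "d \<le> d'" "k dvd d * d'" and p: "0 < p" "p \<le> q"
    and ab: "k \<le> a" "a \<le> d" "k \<le> b" "b \<le> d'" "k dvd a * b"
    and few: "(d - a) + (d' - b) < k" and proper: "a * b < d * d'"
  shows "\<exists>\<Psi>. SUEB (p * d) (q * d') (p * k) (p * q * d * d' - p * (d * d' - a * b)) \<Psi>"
proof -
  define Q where "Q m = (if m = 0 then {..<a} \<times> {..<b} else {..<d} \<times> {..<d'})" for m :: nat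
  \<comment> \<open>The block column in which diagonal \<open>m\<close> meets block row
    \<open>i\<close>; \<open>p \<le> q\<close> makes it injective on the block rows.\<close>
  define \<sigma> where "\<sigma> m i = (i + m) mod q" for m i
  define S where "S m = block_cell d d' (\<sigma> m) ` ({..<p} \<times> Q m)" for m
  \<comment> \<open>All holes are in the blocks \<open>(i, i)\<close> with \<open>i < p\<close>, so
    only the first \<open>p\<close> block columns contribute to \<open>Y\<close>.\<close>
  define X where "X = (\<lambda>(i, x). i * d + x) ` ({..<p} \<times> {a..<d})"
  define Y where "Y = (\<lambda>(i, y). i * d' + y) ` ({..<p} \<times> {b..<d'})"
  have pos: "0 < d" "0 < d'" "0 < q" using k p by auto
  have Q: "Q m \<subseteq> {..<d} \<times> {..<d'}" for m using ab by (auto simp: Q_def)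
  \<comment> \<open>Used for both arguments of \<open>\<sigma>\<close>: it makes each
    \<open>\<sigma> m\<close> injective and separates the diagonals within a block row.\<close>
  have cong: "m = m'" if "(i + m) mod q = (i + m') mod q" "m < q" "m' < q" for i m m'
  proof -
    have "[m = m'] (mod q)" using that(1) by (metis cong_add_lcancel_nat cong_def)
    then show ?thesis using that by (simp add: cong_def)
  qed
  have inj: "inj_on (\<sigma> m) {..<p}" for m
  proof (rule inj_onI)
    fix i j assume "i \<in> {..<p}" "j \<in> {..<p}" "\<sigma> m i = \<sigma> m j"
    then show "i = j" using cong[of m i j] p by (simp add: \<sigma>_def add.commute)
  qed
  have tiledS: "tiled (p * k) (S m)" for m
    unfolding S_def using Q inj tiled_rectangle[of k d d'] tiled_rectangle[of k a b] k ab
    by (intro tiled_blocks) (auto simp: Q_def)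
  have disj: "disjoint_family_on S {..<q}"
    unfolding disjoint_family_on_def
  proof (intro ballI impI)
    fix m m' assume m: "m \<in> {..<q}" "m' \<in> {..<q}" "m \<noteq> m'"
    have "False" if cS: "c \<in> S m" "c \<in> S m'" for c
    proof -
      obtain i x y where c: "c = (i * d + x, \<sigma> m i * d' + y)" "(x, y) \<in> Q m"
        using cS(1) unfolding S_def block_cell_def by auto
      obtain i' x' y' where c': "c = (i' * d + x', \<sigma> m' i' * d' + y')" "(x', y') \<in> Q m'"
        using cS(2) unfolding S_def block_cell_def by auto
      have "x < d" "x' < d" "y < d'" "y' < d'" using c(2) c'(2) Q[of m] Q[of m'] by auto
      then have "i = i'" "\<sigma> m i = \<sigma> m' i'" using c(1) c'(1) by (auto simp: mult_add_eq_iff)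
      then show False using cong[of i m m'] m by (simp add: \<sigma>_def)
    qed
    then show "S m \<inter> S m' = {}" by blast
  qed
  have finQ: "finite (Q m)" for m by (simp add: Q_def)
  have cardS: "card (S m) = p * (if m = 0 then a * b else d * d')" for m
    unfolding S_def by (subst card_image[OF inj_on_block_cell[OF Q]])
      (simp add: card_cartesian_product Q_def)
  have "card (\<Union>m<q. S m) = (\<Sum>m<q. card (S m))"
    using disj finQ by (intro card_UN_disjoint) (auto simp: disjoint_family_on_def S_def)
  also have "\<dots> = card (S 0) + (\<Sum>m\<in>{..<q} - {0}. card (S m))"
    using pos by (intro sum.remove) auto
  also have "(\<Sum>m\<in>{..<q} - {0}. card (S m)) = (q - 1) * (p * (d * d'))"
    using pos by (simp add: cardS)
  finally have "card (\<Union>m<q. S m) = p * (a * b) + (q - 1) * (p * (d * d'))"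
    by (simp add: cardS)
  moreover have "p * q * d * d' = p * (d * d') + (q - 1) * (p * (d * d'))"
    using pos by (cases q) (auto simp: algebra_simps)
  \<comment> \<open>Since \<open>a * b < d * d'\<close>, the truncated subtraction is exact.\<close>
  moreover have "p * (d * d') = p * (a * b) + p * (d * d' - a * b)"
    using proper by (metis add_diff_inverse_nat distrib_left not_less_iff_gr_or_eq)
  ultimately have card: "card (\<Union>m<q. S m) = p * q * d * d' - p * (d * d' - a * b)"
    by simp
  have "\<exists>\<Psi>. SUEB (p * d) (q * d') (p * k) (card (\<Union>m<q. S m)) \<Psi>"
  proof (rule SUEB_of_tiled)
    show "tiled (p * k) (\<Union>m<q. S m)" using tiledS disj by (rule tiled_UN)
    have "i * d + x < p * d \<and> \<sigma> m i * d' + y < q * d'" if "i < p" "(x, y) \<in> Q m" for m i x y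
    proof -
      have xy: "x < d" "y < d'" using that(2) Q[of m] by auto
      have "\<sigma> m i < q" using pos by (simp add: \<sigma>_def)
      then have "Suc i * d \<le> p * d" "Suc (\<sigma> m i) * d' \<le> q * d'"
        using that by (intro mult_right_mono; simp)+
      then show ?thesis using xy by simp
    qed
    then show "(\<Union>m<q. S m) \<subseteq> {..<p * d} \<times> {..<q * d'}"
      by (force simp: S_def block_cell_def)
    have "0 < p * (d * d' - a * b)" "0 < p * q * d * d'" using proper p pos by auto
    then show "card (\<Union>m<q. S m) < p * d * (q * d')"
      unfolding card by (metis diff_less mult.assoc mult.left_commute)
    show "finite X" "finite Y" by (simp_all add: X_def Y_def)
    have "card X \<le> p * (d - a)" "card Y \<le> p * (d' - b)"
      unfolding X_def Y_def by (rule order_trans[OF card_image_le]; simp add: card_cartesian_product)+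
    then have "card X + card Y \<le> p * ((d - a) + (d' - b))" by (simp add: distrib_left)
    also have "\<dots> < p * k" using few p by simp
    finally show "card X + card Y < p * k" .
  next
    fix x y assume xy: "x < p * d" "y < q * d'" "(x, y) \<notin> (\<Union>m<q. S m)"
    define i where "i = x div d"
    define j where "j = y div d'"
    \<comment> \<open>The diagonal through block \<open>(i, j)\<close>; adding \<open>q\<close>
      first keeps the subtraction from truncating, as \<open>i < p \<le> q\<close>.\<close>
    define m where "m = (j + q - i) mod q"
    have ij: "i < p" "j < q"
      using xy by (simp_all add: i_def j_def less_mult_imp_div_less)
    have m: "m < q" using pos by (simp add: m_def)
    have "\<sigma> m i = (i + (j + q - i)) mod q" by (simp add: \<sigma>_def m_def mod_add_right_eq)
    also have "i + (j + q - i) = j + q" using ij p by simp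
    finally have \<sigma>: "\<sigma> m i = j" using ij by simp
    have xy_eq: "x = i * d + x mod d" "y = j * d' + y mod d'" by (simp_all add: i_def j_def)
    have lt: "x mod d < d" "y mod d' < d'" using pos by auto
    have notin: "(x mod d, y mod d') \<notin> Q m"
    proof
      assume "(x mod d, y mod d') \<in> Q m"
      then have "block_cell d d' (\<sigma> m) (i, x mod d, y mod d') \<in> S m"
        using ij by (auto simp: S_def)
      then show False using xy(3) m \<sigma> xy_eq by (auto simp: block_cell_def)
    qed
    \<comment> \<open>Blocks off diagonal 0 are full, so an uncovered cell forces
      \<open>m = 0\<close> and hence a block with \<open>j = i\<close>.\<close>
    then have "m = 0" using lt by (auto simp: Q_def split: if_splits)
    then have "j = i" using \<sigma> ij p by (simp add: \<sigma>_def)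
    have "a \<le> x mod d \<or> b \<le> y mod d'" using notin \<open>m = 0\<close> by (auto simp: Q_def)
    then show "x \<in> X \<or> y \<in> Y"
    proof
      assume "a \<le> x mod d"
      then have "(i, x mod d) \<in> {..<p} \<times> {a..<d}" using lt ij by simp
      then show ?thesis unfolding X_def using xy_eq(1) by (metis (mono_tags, lifting) case_prod_conv image_eqI)
    next
      assume "b \<le> y mod d'"
      then have "(i, y mod d') \<in> {..<p} \<times> {b..<d'}" using lt ij by simp
      then show ?thesis unfolding Y_def using xy_eq(2) \<open>j = i\<close> by (metis (mono_tags, lifting) case_prod_conv image_eqI)
    qed
  qed
  then show ?thesis by (simp only: card)
qed

theorem theorem4p1:
  fixes k d d' p q N :: nat
    and A :: "nat \<Rightarrow> complex mat"
    and R :: "(nat \<times> nat) set"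
  assumes "1 \<le> k" and "k \<le> d" and "d \<le> d'" and "k dvd d * d'"
    and "0 < p" and "p \<le> q"
    and "SUEB d d' k N A"
    and "orthogonal_basis_of d d' (supported_matrices d d' R) N A"
    and "\<forall>j\<in>{1..N}. filter_mset (\<lambda>\<sigma>. \<sigma> \<noteq> 0) (singular_values (A j))
                     = replicate_mset k (1 / sqrt (real k))"
    and "(k dvd d \<and>
            (\<exists>i\<in>{1..k - 1}. d' - i \<ge> k \<and> R = {..<d} \<times> {..<d' - i})) \<or>
         (\<exists>s r. d = s * k + r \<and> 0 < r \<and> r < k \<and>
            (\<exists>t\<in>{0..k - r - 1}. d' - t \<ge> k \<and> R = {..<s * k} \<times> {..<d' - t})) \<or>
         (k dvd d' \<and>
            (\<exists>i\<in>{1..k - 1}. d - i \<ge> k \<and> R = {..<d - i} \<times> {..<d'})) \<or>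
         (\<exists>s r. d' = s * k + r \<and> 0 < r \<and> r < k \<and>
            (\<exists>t\<in>{0..k - r - 1}. d - t \<ge> k \<and> R = {..<d - t} \<times> {..<s * k}))"
  shows "\<exists>\<Psi>. SUEB (p * d) (q * d') (p * k) (p * q * d * d' - p * (d * d' - N)) \<Psi>"
proof -
  \<comment> \<open>\<open>k \<le> n\<close> and \<open>r < k\<close> exclude
    \<open>s = 0\<close>.\<close>
  have ge: "k \<le> s * k" if "n = s * k + r" "r < k" "k \<le> n" for n s r
    using that by (cases s) auto
  \<comment> \<open>All four regions are rectangles. The rows and columns missing from them number
    \<open>i\<close> or \<open>r + t\<close>, in either case at most \<open>k - 1\<close>.\<close>
  have "\<exists>a b. R = {..<a} \<times> {..<b} \<and> k \<le> a \<and> a \<le> d \<and> k \<le> b \<and> b \<le> d' \<and> k dvd a * b \<and>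
      (d - a) + (d' - b) < k"
    using assms(10)
  proof (elim disjE conjE exE bexE)
    fix i assume "k dvd d" "i \<in> {1..k - 1}" "d' - i \<ge> k" "R = {..<d} \<times> {..<d' - i}"
    then show ?thesis
      using assms(1,2) by (intro exI[of _ d] exI[of _ "d' - i"]) auto
  next
    fix s r t assume "d = s * k + r" "0 < r" "r < k" "t \<in> {0..k - r - 1}" "d' - t \<ge> k"
      "R = {..<s * k} \<times> {..<d' - t}"
    then show ?thesis
      using assms(1,2) ge[of d s r] by (intro exI[of _ "s * k"] exI[of _ "d' - t"]) auto
  next
    fix i assume "k dvd d'" "i \<in> {1..k - 1}" "d - i \<ge> k" "R = {..<d - i} \<times> {..<d'}"
    then show ?thesis
      using assms(1-3) by (intro exI[of _ "d - i"] exI[of _ d']) auto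
  next
    fix s r t assume "d' = s * k + r" "0 < r" "r < k" "t \<in> {0..k - r - 1}" "d - t \<ge> k"
      "R = {..<d - t} \<times> {..<s * k}"
    then show ?thesis
      using assms(1-3) ge[of d' s r] by (intro exI[of _ "d - t"] exI[of _ "s * k"]) auto
  qed
  then obtain a b where ab: "R = {..<a} \<times> {..<b}" "k \<le> a" "a \<le> d" "k \<le> b" "b \<le> d'"
      "k dvd a * b" "(d - a) + (d' - b) < k"
    by blast
  \<comment> \<open>\<open>SUEB\<close> makes the orthogonal basis orthonormal, so \<open>N\<close>
    counts the cells of \<open>R\<close>; its bound \<open>N < d * d'\<close> then shows that the
    rectangle is proper.\<close>
  have "N = card R"
    using assms(7,8) ab(1,3,5)
    by (intro card_orthonormal_basis_supported_matrices) (auto simp: SUEB_def)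
  then have N: "N = a * b" using ab(1) by (simp add: card_cartesian_product)
  moreover have "N < d * d'" using assms(7) by (simp add: SUEB_def)
  ultimately show ?thesis
    using SUEB_of_rectangle[OF assms(1-6) ab(2-7)] by simp
qed

end
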